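(* Let $X \in L^1(\mathbf P)$. Then $$\boldsymbol\lambda^2[\mathcal E_X] = \frac12\int_{\mathbb R} \rho_{\mathcal E_X}(1,x)^2\,dx = \frac12\left\{\int_{-\infty}^{\mathbf E[X]} \big(e_X^{-1}(x)\big)^2\,dx + \int_{\mathbf E[X]}^{\infty}\big(1-e_X^{-1}(x)\big)^2\,dx\right\}.$$
   Context: $(\Omega,\mathcal A,\mathbf P)$ is a complete probability space and $L^1(\mathbf P)$ is the space of real-valued integrable random variables (identified up to $\mathbf P$-a.s. equality). Write $a_+=\max\{0,a\}$, $a_-=\max\{0,-a\}$. For $X\in L^1(\mathbf P)$ and $\alpha\in(0,1)$, the $\alpha$-expectile $e_X(\alpha)$ is the unique real number satisfying $(1-\alpha)\,\mathbf E[(X-e_X(\alpha))_-]=\alpha\,\mathbf E[(X-e_X(\alpha))_+]$; in particular $e_X(1/2)=\mathbf E[X]$. For $\alpha\in(0,1/2]$ the expectile region is the interval $E_X(\alpha)=[e_X(\alpha),e_X(1-\alpha)]$. The inverse expectile function $e_X^{-1}:\mathbb R\to[0,1]$ is defined by $e_X^{-1}(x)=0$ for $x\le \operatorname{ess\,inf}X$, $e_X^{-1}(x)=\mathbf E[(X-x)_-]/\mathbf E[|X-x|]$ for $\operatorname{ess\,inf}X<x<\operatorname{ess\,sup}X$, and $e_X^{-1}(x)=1$ for $x\ge\operatorname{ess\,sup}X$ (if $X$ is a.s. constant the first and last cases overlap at a single point, whose value is irrelevant to the integrals). The expectile star-shaped set of $X$ is the closed planar set $$\mathcal E_X=\operatorname{cl}\{(t,x)\in\mathbb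 R^2 : t\in(0,1/2],\ t^{-1}x\in E_X(t)\},$$ and its radial function is $\rho_{\mathcal E_X}(1,x)=\sup\{\theta\ge 0 : \theta\,(1,x)\in\mathcal E_X\}$, $x\in\mathbb R$. $\boldsymbol\lambda^2$ denotes two-dimensional Lebesgue measure. *)

theory Defs
  imports "HOL-Probability.Probability"
begin

definition pos_part :: "real \<Rightarrow> real" where
  "pos_part a = max 0 a"

definition neg_part :: "real \<Rightarrow> real" where
  "neg_part a = max 0 (- a)"

text \<open>The description below determines a unique real number when the measure is a probability
  measure, \<open>X\<close> is integrable and \<open>0 < \<alpha> < 1\<close>.\<close>

definition expectile :: "'a measure \<Rightarrow> ('a \<Rightarrow> real) \<Rightarrow> real \<Rightarrow> real" where
  "expectile M X \<alpha> = (THE e.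
     (1 - \<alpha>) * (\<integral>\<omega>. neg_part (X \<omega> - e) \<partial>M) = \<alpha> * (\<integral>\<omega>. pos_part (X \<omega> - e) \<partial>M))"

definition expectile_region :: "'a measure \<Rightarrow> ('a \<Rightarrow> real) \<Rightarrow> real \<Rightarrow> real set" where
  "expectile_region M X \<alpha> = {expectile M X \<alpha> .. expectile M X (1 - \<alpha>)}"

text \<open>Essential bounds of a real random variable live in the extended reals, as they may be
  infinite.\<close>

definition ess_sup :: "'a measure \<Rightarrow> ('a \<Rightarrow> real) \<Rightarrow> ereal" where
  "ess_sup M X = esssup M (\<lambda>\<omega>. ereal (X \<omega>))"

definition ess_inf :: "'a measure \<Rightarrow> ('a \<Rightarrow> real) \<Rightarrow> ereal" where
  "ess_inf M X = - esssup M (\<lambda>\<omega>. - ereal (X \<omega>))"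

text \<open>The cases \<open>x \<le> ess inf\<close> and \<open>x \<ge> ess sup\<close> overlap only when \<open>X\<close> is almost surely constant, and then at a single
  point; the value chosen there is \<open>0\<close>.\<close>

definition inv_expectile :: "'a measure \<Rightarrow> ('a \<Rightarrow> real) \<Rightarrow> real \<Rightarrow> real" where
  "inv_expectile M X x =
     (if ereal x \<le> ess_inf M X then 0
      else if ess_sup M X \<le> ereal x then 1
      else (\<integral>\<omega>. neg_part (X \<omega> - x) \<partial>M) / (\<integral>\<omega>. \<bar>X \<omega> - x\<bar> \<partial>M))"

definition expectile_star_set :: "'a measure \<Rightarrow> ('a \<Rightarrow> real) \<Rightarrow> (real \<times> real) set" where
  "expectile_star_set M X =
     closure {(t, x). t \<in> {0<..1/2} \<and> inverse t * x \<in> expectile_region M X t}"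

text \<open>The supremum is the one of the reals. For an expectile star-shaped set \<open>K\<close> and \<open>u = (1, x)\<close>
  the set of admissible \<open>\<theta>\<close> contains \<open>0\<close> and is bounded by \<open>1/2\<close>.\<close>

definition radial_function :: "(real \<times> real) set \<Rightarrow> real \<times> real \<Rightarrow> real" where
  "radial_function K u = Sup {\<theta>. 0 \<le> \<theta> \<and> \<theta> *\<^sub>R u \<in> K}"

end

(* With N(y) = E[(X - y)_-] and P(y) = E[(X - y)_+], the point y lies in E_X(t) iff
   t E|X - y| <= min(N(y), P(y)), that is, iff t <= r(y) := min(N(y), P(y)) / E|X - y|. Since
   N and P are continuous, taking the closure only adds points of the line t = 0, so the radial
   function in direction (1, y) is r(y), and integrating in the coordinates (t, x) = (t, t y) gives
   the area as half the integral of r^2. As P(y) - N(y) = E[X] - y, the minimum is N(y) to the left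
   of E[X] and P(y) to its right, which expresses r through the inverse expectile function. *)

theory Submission
  imports Defs
begin

section \<open>Lower, upper and absolute mean deviations as functions of the centre\<close>

definition lower_mean :: "'a measure \<Rightarrow> ('a \<Rightarrow> real) \<Rightarrow> real \<Rightarrow> real" where
  "lower_mean M X x = (\<integral>\<omega>. neg_part (X \<omega> - x) \<partial>M)"

definition upper_mean :: "'a measure \<Rightarrow> ('a \<Rightarrow> real) \<Rightarrow> real \<Rightarrow> real" where
  "upper_mean M X x = (\<integral>\<omega>. pos_part (X \<omega> - x) \<partial>M)"

definition abs_mean :: "'a measure \<Rightarrow> ('a \<Rightarrow> real) \<Rightarrow> real \<Rightarrow> real" where
  "abs_mean M X x = (\<integral>\<omega>. \<bar>X \<omega> - x\<bar> \<partial>M)"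

text \<open>The largest \<open>t \<le> 1/2\<close> with \<open>y \<in> E\<^sub>X(t)\<close>; the first case is an almost surely constant \<open>X = y\<close>.\<close>

definition expectile_depth :: "'a measure \<Rightarrow> ('a \<Rightarrow> real) \<Rightarrow> real \<Rightarrow> real" where
  "expectile_depth M X y =
     (if abs_mean M X y = 0 then 1/2
      else min (lower_mean M X y) (upper_mean M X y) / abs_mean M X y)"

locale integrable_random_variable = prob_space +
  fixes X :: "'a \<Rightarrow> real"
  assumes integrable_X: "integrable M X"
begin

lemma integrable_neg_part: "integrable M (\<lambda>\<omega>. neg_part (X \<omega> - x))"
  and integrable_pos_part: "integrable M (\<lambda>\<omega>. pos_part (X \<omega> - x))"
  unfolding neg_part_def pos_part_def using integrable_X by auto

lemma lower_mean_nonneg: "0 \<le> lower_mean M X x"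
  and upper_mean_nonneg: "0 \<le> upper_mean M X x"
  and abs_mean_nonneg: "0 \<le> abs_mean M X x"
  unfolding lower_mean_def upper_mean_def abs_mean_def neg_part_def pos_part_def
  by (auto intro!: integral_nonneg_AE)

lemma lower_add_upper: "lower_mean M X x + upper_mean M X x = abs_mean M X x"
  unfolding lower_mean_def upper_mean_def abs_mean_def
  by (subst Bochner_Integration.integral_add[symmetric, OF integrable_neg_part integrable_pos_part])
     (auto simp: neg_part_def pos_part_def intro!: Bochner_Integration.integral_cong)

lemma upper_diff_lower: "upper_mean M X x - lower_mean M X x = expectation X - x"
proof -
  have "upper_mean M X x - lower_mean M X x = (\<integral>\<omega>. X \<omega> - x \<partial>M)"
    unfolding lower_mean_def upper_mean_def
    by (subst Bochner_Integration.integral_diff[symmetric, OF integrable_pos_part integrable_neg_part])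
       (auto simp: neg_part_def pos_part_def intro!: Bochner_Integration.integral_cong)
  also have "\<dots> = expectation X - x"
    using integrable_X by (simp add: prob_space)
  finally show ?thesis .
qed

lemma lower_mean_mono: "x \<le> y \<Longrightarrow> lower_mean M X x \<le> lower_mean M X y"
  unfolding lower_mean_def
  by (intro integral_mono integrable_neg_part) (auto simp: neg_part_def)

lemma upper_mean_antimono: "x \<le> y \<Longrightarrow> upper_mean M X y \<le> upper_mean M X x"
  unfolding upper_mean_def
  by (intro integral_mono integrable_pos_part) (auto simp: pos_part_def)

text \<open>By \<open>upper_diff_lower\<close>, lower minus upper mean has slope exactly one. Since
  the upper mean does not increase, the lower mean gains at most \<open>y - x\<close>.\<close>

lemma lower_mean_lipschitz: "x \<le> y \<Longrightarrow> lower_mean M X y \<le> lower_mean M X x + (y - x)"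
  using upper_diff_lower[of x] upper_diff_lower[of y] upper_mean_antimono[of x y] by linarith

lemma continuous_on_lower_mean: "continuous_on S (lower_mean M X)"
proof -
  have "\<bar>lower_mean M X y - lower_mean M X x\<bar> \<le> 1 * \<bar>y - x\<bar>" for x y
    using lower_mean_mono[of x y] lower_mean_mono[of y x]
      lower_mean_lipschitz[of x y] lower_mean_lipschitz[of y x]
    by (cases "x \<le> y") auto
  then have "1-lipschitz_on S (lower_mean M X)"
    by (intro lipschitz_onI) (auto simp: dist_real_def)
  then show ?thesis
    by (rule lipschitz_on_continuous_on)
qed

lemma continuous_on_upper_mean: "continuous_on S (upper_mean M X)"
proof -
  have "upper_mean M X = (\<lambda>x. lower_mean M X x + (expectation X - x))"
    using upper_diff_lower by (auto simp: fun_eq_iff algebra_simps)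
  then show ?thesis
    by (simp only:) (intro continuous_intros continuous_on_lower_mean)
qed

lemma continuous_on_abs_mean: "continuous_on S (abs_mean M X)"
  unfolding lower_add_upper[symmetric, abs_def]
  by (intro continuous_intros continuous_on_lower_mean continuous_on_upper_mean)

section \<open>Expectiles and their regions as inequalities between mean deviations\<close>

text \<open>The fall \<open>a\<close> of the upper mean and the rise \<open>b\<close> of the lower
  mean are nonnegative and add up to \<open>y - x\<close>; \<open>g\<close> falls by their
  combination with weights \<alpha> and 1 - \<alpha>. A slope bounded away from zero gives existence
  as well as uniqueness of the expectile.\<close>

lemma expectile_function_decreasing:
  assumes "0 < \<alpha>" "\<alpha> < 1" "x \<le> y"
  defines "g \<equiv> \<lambda>x. \<alpha> * upper_mean M X x - (1 - \<alpha>) * lower_mean M X x"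
  shows "min \<alpha> (1 - \<alpha>) * (y - x) \<le> g x - g y"
proof -
  define a where "a = upper_mean M X x - upper_mean M X y"
  define b where "b = lower_mean M X y - lower_mean M X x"
  have a: "a \<ge> 0" and b: "b \<ge> 0" and ab: "y - x = a + b"
    using lower_mean_mono upper_mean_antimono \<open>x \<le> y\<close> upper_diff_lower[of x] upper_diff_lower[of y]
    unfolding a_def b_def by auto
  have "min \<alpha> (1 - \<alpha>) * (y - x) = min \<alpha> (1 - \<alpha>) * a + min \<alpha> (1 - \<alpha>) * b"
    by (simp add: ab algebra_simps)
  also have "\<dots> \<le> \<alpha> * a + (1 - \<alpha>) * b"
    by (intro add_mono mult_right_mono a b) auto
  also have "\<dots> = g x - g y"
    by (simp add: g_def a_def b_def algebra_simps)
  finally show ?thesis .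
qed

text \<open>The expectile is the only zero of a strictly decreasing function \<open>g\<close>, so
  its position relative to \<open>y\<close> is read off from the sign of \<open>g y\<close>.\<close>

lemma expectile_iff:
  assumes \<alpha>: "0 < \<alpha>" "\<alpha> < 1"
  shows expectile_le_iff:
      "expectile M X \<alpha> \<le> y \<longleftrightarrow> \<alpha> * upper_mean M X y \<le> (1 - \<alpha>) * lower_mean M X y"
    and le_expectile_iff:
      "y \<le> expectile M X \<alpha> \<longleftrightarrow> (1 - \<alpha>) * lower_mean M X y \<le> \<alpha> * upper_mean M X y"
proof -
  define c where "c = min \<alpha> (1 - \<alpha>)"
  define g where "g x = \<alpha> * upper_mean M X x - (1 - \<alpha>) * lower_mean M X x" for x
  have c: "c > 0" using \<alpha> by (simp add: c_def)
  have dec: "c * (y - x) \<le> g x - g y" if "x \<le> y" for x y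
    using expectile_function_decreasing[OF \<alpha> that] by (simp add: c_def g_def)
  have strict: "g y < g x" if "x < y" for x y
    using dec[of x y] that mult_pos_pos[of c "y - x"] c by linarith
  \<comment> \<open>As \<open>g\<close> falls at rate at least \<open>c\<close>, moving a distance
    \<open>\<bar>g 0\<bar> / c\<close> from 0 in either direction suffices to reach a value of the
    required sign.\<close>
  define K where "K = \<bar>g 0\<bar> / c"
  have K: "K \<ge> 0" "c * K = \<bar>g 0\<bar>"
    using c by (auto simp: K_def)
  have "g K \<le> 0" "0 \<le> g (-K)"
    using dec[of 0 K] dec[of "-K" 0] K by auto
  moreover have "continuous_on {-K..K} g"
    unfolding g_def
    by (intro continuous_intros continuous_on_upper_mean continuous_on_lower_mean)
  ultimately obtain e where e: "g e = 0"
    using IVT2'[of g K 0 "-K"] K by auto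
  have uniq: "x = e" if "g x = 0" for x
    using strict[of x e] strict[of e x] that e by (cases x e rule: linorder_cases) auto
  have "expectile M X \<alpha> = (THE e. g e = 0)"
    unfolding expectile_def g_def lower_mean_def upper_mean_def
    by (rule arg_cong[of _ _ The]) auto
  also have "\<dots> = e"
    using e uniq by (rule the_equality)
  finally have "expectile M X \<alpha> = e" .
  moreover have "e \<le> y \<longleftrightarrow> g y \<le> 0" "y \<le> e \<longleftrightarrow> 0 \<le> g y"
    using strict[of y e] strict[of e y] e by (cases y e rule: linorder_cases; auto)+
  ultimately show "expectile M X \<alpha> \<le> y \<longleftrightarrow> \<alpha> * upper_mean M X y \<le> (1 - \<alpha>) * lower_mean M X y"
    and "y \<le> expectile M X \<alpha> \<longleftrightarrow> (1 - \<alpha>) * lower_mean M X y \<le> \<alpha> * upper_mean M X y"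
    by (simp_all add: g_def)
qed

text \<open>Adding \<open>t\<close> times the lower mean to both sides of the condition at level
  \<open>t\<close> turns its left side into \<open>t * abs_mean M X y\<close> and its right side
  into the lower mean. Level 1 - t is symmetric, with the upper mean.\<close>

lemma mem_expectile_region_iff:
  assumes "0 < t" "t \<le> 1/2"
  shows "y \<in> expectile_region M X t \<longleftrightarrow>
    t * abs_mean M X y \<le> min (lower_mean M X y) (upper_mean M X y)"
  using expectile_le_iff[of t y] le_expectile_iff[of "1 - t" y] assms
  unfolding expectile_region_def lower_add_upper[symmetric]
  by (auto simp: algebra_simps)

section \<open>The depth function\<close>

lemma min_mean_le: "min (lower_mean M X y) (upper_mean M X y) \<le> 1/2 * abs_mean M X y"
  unfolding lower_add_upper[symmetric] by auto

lemma expectile_depth_nonneg: "0 \<le> expectile_depth M X y"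
  using lower_mean_nonneg upper_mean_nonneg abs_mean_nonneg by (auto simp: expectile_depth_def)

text \<open>A division-free form, whose inequalities are preserved under limits. The bound 1/2
  matters only if \<open>abs_mean M X y = 0\<close>, where the product inequality holds for every
  \<open>t\<close>; otherwise it follows from \<open>min_mean_le\<close>.\<close>

lemma le_expectile_depth_iff:
  "t \<le> expectile_depth M X y \<longleftrightarrow>
    t \<le> 1/2 \<and> t * abs_mean M X y \<le> min (lower_mean M X y) (upper_mean M X y)"
proof (cases "abs_mean M X y = 0")
  case True
  then have "lower_mean M X y = 0" "upper_mean M X y = 0"
    using lower_add_upper[of y] lower_mean_nonneg[of y] upper_mean_nonneg[of y] by linarith+
  with True show ?thesis by (simp add: expectile_depth_def)
next
  case False
  then have pos: "abs_mean M X y > 0" using abs_mean_nonneg[of y] by linarith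
  then have "t \<le> expectile_depth M X y \<longleftrightarrow>
      t * abs_mean M X y \<le> min (lower_mean M X y) (upper_mean M X y)"
    unfolding expectile_depth_def using False by (simp only: if_False pos_le_divide_eq)
  moreover have "t \<le> 1/2" if "t * abs_mean M X y \<le> min (lower_mean M X y) (upper_mean M X y)"
    using order_trans[OF that min_mean_le] pos by (rule mult_right_le_imp_le)
  ultimately show ?thesis by blast
qed

lemma expectile_depth_mean: "expectile_depth M X (expectation X) = 1/2"
proof (rule antisym)
  show "expectile_depth M X (expectation X) \<le> 1/2"
    using le_expectile_depth_iff[of "expectile_depth M X (expectation X)" "expectation X"] by simp
  show "1/2 \<le> expectile_depth M X (expectation X)"
    using upper_diff_lower[of "expectation X"] lower_add_upper[of "expectation X"]
    by (simp add: le_expectile_depth_iff)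
qed

lemma measurable_expectile_depth [measurable]: "expectile_depth M X \<in> borel_measurable borel"
proof -
  have [measurable]: "lower_mean M X \<in> borel_measurable borel"
    "upper_mean M X \<in> borel_measurable borel" "abs_mean M X \<in> borel_measurable borel"
    by (intro borel_measurable_continuous_onI continuous_on_lower_mean continuous_on_upper_mean
        continuous_on_abs_mean)+
  show ?thesis
    unfolding expectile_depth_def by measurable
qed

section \<open>The star-shaped set and its radial function\<close>

text \<open>Taking the closure adds nothing off the line t = 0: there x / t depends continuously on
  the point, and the division-free inequalities are closed conditions. The depth itself may jump:
  for an almost surely constant \<open>X\<close> it is 1/2 at the constant and 0 elsewhere.\<close>

lemma mem_star_set_iff:
  assumes "0 < t"
  shows "(t, x) \<in> expectile_star_set M X \<longleftrightarrow> t \<le> expectile_depth M X (x / t)"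
proof -
  define S where "S = {(t, x). t \<in> {0<..1/2} \<and> inverse t * x \<in> expectile_region M X t}"
  define h where "h y = min (lower_mean M X y) (upper_mean M X y)" for y
  have cont_h: "continuous_on UNIV h"
    unfolding h_def by (intro continuous_intros continuous_on_lower_mean continuous_on_upper_mean)
  have S_iff: "(s, z) \<in> S \<longleftrightarrow> 0 < s \<and> s \<le> expectile_depth M X (z / s)" for s z
  proof -
    have "inverse s * z = z / s" by (simp add: field_simps)
    then show ?thesis
      by (auto simp: S_def mem_expectile_region_iff le_expectile_depth_iff)
  qed
  have "(t, x) \<in> S" if "(t, x) \<in> closure S"
  proof -
    obtain f where f: "\<And>n. f n \<in> S" "f \<longlonglongrightarrow> (t, x)"
      using \<open>(t, x) \<in> closure S\<close> by (auto simp: closure_sequential)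
    define a b where "a n = fst (f n)" and "b n = snd (f n)" for n
    have a: "a \<longlonglongrightarrow> t" and b: "b \<longlonglongrightarrow> x"
      using tendsto_fst[OF f(2)] tendsto_snd[OF f(2)] by (simp_all add: a_def[abs_def] b_def[abs_def])
    have ba: "(\<lambda>n. b n / a n) \<longlonglongrightarrow> x / t"
      using \<open>0 < t\<close> by (intro tendsto_divide a b) auto
    have "(a n, b n) \<in> S" for n
      using f(1)[of n] by (simp add: a_def b_def)
    then have *: "a n \<le> 1/2" "a n * abs_mean M X (b n / a n) \<le> h (b n / a n)" for n
      by (auto simp: S_iff le_expectile_depth_iff h_def)
    have "t \<le> 1/2"
      using a *(1) by (intro LIMSEQ_le_const2) auto
    moreover have "t * abs_mean M X (x / t) \<le> h (x / t)"
    proof (rule LIMSEQ_le)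
      show "(\<lambda>n. a n * abs_mean M X (b n / a n)) \<longlonglongrightarrow> t * abs_mean M X (x / t)"
        by (intro tendsto_mult a continuous_on_tendsto_compose[OF continuous_on_abs_mean[of UNIV] ba]) auto
      show "(\<lambda>n. h (b n / a n)) \<longlonglongrightarrow> h (x / t)"
        by (intro continuous_on_tendsto_compose[OF cont_h ba]) auto
    qed (use *(2) in auto)
    ultimately show ?thesis
      using \<open>0 < t\<close> by (simp add: S_iff le_expectile_depth_iff h_def)
  qed
  then have "(t, x) \<in> closure S \<longleftrightarrow> (t, x) \<in> S"
    using closure_subset[of S] by blast
  then show ?thesis
    using \<open>0 < t\<close> unfolding expectile_star_set_def S_def[symmetric] by (simp add: S_iff)
qed

lemma closed_star_set: "closed (expectile_star_set M X)"
  by (simp add: expectile_star_set_def)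

lemma star_set_nonneg: "(t, x) \<in> expectile_star_set M X \<Longrightarrow> 0 \<le> t"
proof -
  have "expectile_star_set M X \<subseteq> {0..} \<times> UNIV"
    unfolding expectile_star_set_def by (intro closure_minimal) (auto intro: closed_Times)
  then show "(t, x) \<in> expectile_star_set M X \<Longrightarrow> 0 \<le> t" by auto
qed

text \<open>The origin is reached only through the closure, as a limit along the ray of slope
  \<open>expectation X\<close>, on which every \<open>t\<close> in (0, 1/2] is admissible. It makes
  \<theta> = 0 admissible in the radial function.\<close>

lemma zero_mem_star_set: "(0, 0) \<in> expectile_star_set M X"
proof (rule closed_sequentially[OF closed_star_set])
  define t where "t n = 1/2 * inverse (real (Suc n))" for n
  have t: "0 < t n" "t n \<le> 1/2" for n
    by (auto simp: t_def field_simps)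
  have lim: "t \<longlonglongrightarrow> 0"
    unfolding t_def using tendsto_mult_right_zero[OF LIMSEQ_inverse_real_of_nat] by blast
  show "(t n, t n * expectation X) \<in> expectile_star_set M X" for n
  proof -
    have "t n * expectation X / t n = expectation X"
      using t(1)[of n] by simp
    then show ?thesis
      unfolding mem_star_set_iff[OF t(1)] by (simp only: expectile_depth_mean t(2))
  qed
  show "(\<lambda>n. (t n, t n * expectation X)) \<longlonglongrightarrow> (0, 0)"
    using tendsto_Pair[OF lim tendsto_mult_left_zero[OF lim]] by simp
qed

lemma radial_function_eq: "radial_function (expectile_star_set M X) (1, x) = expectile_depth M X x"
proof -
  have "{\<theta>. 0 \<le> \<theta> \<and> \<theta> *\<^sub>R (1, x) \<in> expectile_star_set M X} = {0..expectile_depth M X x}"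
  proof (intro set_eqI)
    fix \<theta> :: real
    show "\<theta> \<in> {\<theta>. 0 \<le> \<theta> \<and> \<theta> *\<^sub>R (1, x) \<in> expectile_star_set M X} \<longleftrightarrow>
        \<theta> \<in> {0..expectile_depth M X x}"
      \<comment> \<open>For \<theta> > 0 the point is (\<theta>, \<theta> x), whose slope is x;
        \<theta> = 0 is the origin.\<close>
      by (cases "0::real" \<theta> rule: linorder_cases)
         (auto simp: mem_star_set_iff zero_mem_star_set expectile_depth_nonneg)
  qed
  then show ?thesis
    by (simp add: radial_function_def expectile_depth_nonneg)
qed

section \<open>The area in polar-like coordinates\<close>

text \<open>In the coordinates \<open>(t, x) = (t, t y)\<close>, of Jacobian \<open>t\<close>, the set is \<open>{0 < t \<le> expectile_depth y}\<close>
  up to the null line \<open>t = 0\<close>.\<close>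

lemma emeasure_star_set:
  "emeasure lborel (expectile_star_set M X) =
    1/2 * (\<integral>\<^sup>+x. ennreal ((expectile_depth M X x)\<^sup>2) \<partial>lborel)"
proof -
  let ?E = "expectile_star_set M X" and ?r = "expectile_depth M X"
  have E [measurable]: "?E \<in> sets (borel \<Otimes>\<^sub>M borel)"
    unfolding borel_prod using closed_star_set by (rule borel_closed)
  have "emeasure lborel ?E = emeasure (lborel \<Otimes>\<^sub>M lborel) ?E"
    by (simp add: lborel_prod)
  also have "\<dots> = (\<integral>\<^sup>+t. \<integral>\<^sup>+x. indicator ?E (t, x) \<partial>lborel \<partial>lborel)"
    by (subst lborel.nn_integral_fst) auto
  also have "\<dots> = (\<integral>\<^sup>+t. \<integral>\<^sup>+y. ennreal t * indicator {0..?r y} t \<partial>lborel \<partial>lborel)"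
  proof (rule nn_integral_cong_AE)
    show "AE t in lborel. (\<integral>\<^sup>+x. indicator ?E (t, x) \<partial>lborel) =
        (\<integral>\<^sup>+y. ennreal t * indicator {0..?r y} t \<partial>lborel)"
      using AE_lborel_singleton[of "0::real"]
    proof eventually_elim
      fix t :: real assume "t \<noteq> 0"
      show "(\<integral>\<^sup>+x. indicator ?E (t, x) \<partial>lborel) =
          (\<integral>\<^sup>+y. ennreal t * indicator {0..?r y} t \<partial>lborel)"
      proof (cases "0 < t")
        case True
        have "(\<integral>\<^sup>+x. indicator ?E (t, x) \<partial>lborel) =
            \<bar>t\<bar> * (\<integral>\<^sup>+y. indicator ?E (t, 0 + t * y) \<partial>lborel)"
          \<comment> \<open>Substitution x = t y on the vertical line at \<open>t\<close>, which
            produces the Jacobian factor.\<close>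
          using \<open>t \<noteq> 0\<close> by (intro nn_integral_real_affine) measurable
        also have "(\<integral>\<^sup>+y. indicator ?E (t, 0 + t * y) \<partial>lborel) =
            (\<integral>\<^sup>+y. indicator {0..?r y} t \<partial>lborel)"
          using True by (intro nn_integral_cong) (auto simp: indicator_def mem_star_set_iff)
        also have "\<bar>t\<bar> * \<dots> = (\<integral>\<^sup>+y. ennreal t * indicator {0..?r y} t \<partial>lborel)"
          using True by (subst nn_integral_cmult) (auto simp: indicator_def)
        finally show ?thesis .
      next
        case False
        \<comment> \<open>For t < 0 both sides vanish: the set has no such points, and
          \<open>ennreal t\<close> is 0.\<close>
        then have "(t, x) \<notin> ?E" for x
          using star_set_nonneg[of t x] \<open>t \<noteq> 0\<close> by auto
        with False \<open>t \<noteq> 0\<close> show ?thesis by (simp add: ennreal_neg)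
      qed
    qed
  qed
  also have "\<dots> = (\<integral>\<^sup>+y. \<integral>\<^sup>+t. ennreal t * indicator {0..?r y} t \<partial>lborel \<partial>lborel)"
    by (rule lborel_pair.Fubini') (simp add: indicator_def)
  also have "\<dots> = (\<integral>\<^sup>+y. 1/2 * ennreal ((?r y)\<^sup>2) \<partial>lborel)"
  proof (rule nn_integral_cong)
    fix y
    \<comment> \<open>After the exchange of integrals, the weight \<open>t\<close> has
      antiderivative t * t / 2; this is the source of the factor 1/2.\<close>
    have "(\<integral>\<^sup>+t. ennreal t * indicator {0..?r y} t \<partial>lborel) = ennreal ((?r y)\<^sup>2 / 2 - 0\<^sup>2 / 2)"
      by (rule nn_integral_FTC_Icc)
         (auto intro!: derivative_eq_intros simp: expectile_depth_nonneg)
    also have "\<dots> = ennreal ((?r y)\<^sup>2) * (1/2)"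
      by (simp add: ennreal_divide_numeral[symmetric] ennreal_times_divide)
    also have "\<dots> = 1/2 * ennreal ((?r y)\<^sup>2)"
      by (rule mult.commute)
    finally show "(\<integral>\<^sup>+t. ennreal t * indicator {0..?r y} t \<partial>lborel) = 1/2 * ennreal ((?r y)\<^sup>2)" .
  qed
  also have "\<dots> = 1/2 * (\<integral>\<^sup>+y. ennreal ((?r y)\<^sup>2) \<partial>lborel)"
    by (rule nn_integral_cmult) auto
  finally show ?thesis .
qed

section \<open>Essential bounds and the inverse expectile function\<close>

lemma le_ess_inf_D:
  assumes "ereal x \<le> ess_inf M X"
  shows "AE \<omega> in M. x \<le> X \<omega>"
proof -
  have "AE \<omega> in M. - ereal (X \<omega>) \<le> esssup M (\<lambda>\<omega>. - ereal (X \<omega>))"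
    by (rule esssup_AE)
  then show ?thesis
  proof eventually_elim
    fix \<omega> assume "- ereal (X \<omega>) \<le> esssup M (\<lambda>\<omega>. - ereal (X \<omega>))"
    then have "ess_inf M X \<le> ereal (X \<omega>)"
      unfolding ess_inf_def by (simp add: ereal_uminus_le_reorder)
    with assms have "ereal x \<le> ereal (X \<omega>)" by (rule order_trans)
    then show "x \<le> X \<omega>" by simp
  qed
qed

lemma ess_sup_le_D:
  assumes "ess_sup M X \<le> ereal x"
  shows "AE \<omega> in M. X \<omega> \<le> x"
proof -
  have "AE \<omega> in M. ereal (X \<omega>) \<le> ess_sup M X"
    unfolding ess_sup_def by (rule esssup_AE)
  then show ?thesis
  proof eventually_elim
    fix \<omega> assume "ereal (X \<omega>) \<le> ess_sup M X"
    with assms have "ereal (X \<omega>) \<le> ereal x" by (rule order_trans[rotated])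
    then show "X \<omega> \<le> x" by simp
  qed
qed

lemma le_ess_inf_lower_mean: "ereal x \<le> ess_inf M X \<Longrightarrow> lower_mean M X x = 0"
  unfolding lower_mean_def
  by (rule integral_eq_zero_AE) (use le_ess_inf_D in \<open>fastforce simp: neg_part_def\<close>)

lemma ess_sup_le_upper_mean: "ess_sup M X \<le> ereal x \<Longrightarrow> upper_mean M X x = 0"
  unfolding upper_mean_def
  by (rule integral_eq_zero_AE) (use ess_sup_le_D in \<open>fastforce simp: pos_part_def\<close>)

text \<open>Left of the mean the lower mean is the strict minimum. The upper mean is then positive,
  which excludes the case of value 1; at or below the essential infimum the lower mean vanishes, so
  the depth is 0 as well.\<close>

lemma expectile_depth_below_mean:
  assumes "x < expectation X"
  shows "expectile_depth M X x = inv_expectile M X x"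
proof -
  have less: "lower_mean M X x < upper_mean M X x"
    using upper_diff_lower[of x] assms by linarith
  then have "abs_mean M X x \<noteq> 0"
    using lower_add_upper[of x] lower_mean_nonneg[of x] by linarith
  moreover have "\<not> ess_sup M X \<le> ereal x"
    using ess_sup_le_upper_mean[of x] less lower_mean_nonneg[of x] by auto
  ultimately show ?thesis
    using less le_ess_inf_lower_mean[of x]
    by (simp add: expectile_depth_def inv_expectile_def lower_mean_def[symmetric] abs_mean_def[symmetric])
qed

text \<open>The mirror image: the upper mean is the strict minimum, and its share of
  \<open>abs_mean\<close> complements that of the lower mean to one. From the essential supremum on,
  both sides are 0.\<close>

lemma expectile_depth_above_mean:
  assumes "expectation X < x"
  shows "expectile_depth M X x = 1 - inv_expectile M X x"
proof -
  have less: "upper_mean M X x < lower_mean M X x"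
    using upper_diff_lower[of x] assms by linarith
  then have nz: "abs_mean M X x \<noteq> 0"
    using lower_add_upper[of x] upper_mean_nonneg[of x] by linarith
  have "\<not> ereal x \<le> ess_inf M X"
    using le_ess_inf_lower_mean[of x] less upper_mean_nonneg[of x] by auto
  moreover have "upper_mean M X x / abs_mean M X x = 1 - lower_mean M X x / abs_mean M X x"
    using nz lower_add_upper[of x] by (simp add: field_simps)
  ultimately show ?thesis
    using less nz ess_sup_le_upper_mean[of x] lower_add_upper[of x]
    by (auto simp: expectile_depth_def inv_expectile_def lower_mean_def[symmetric] abs_mean_def[symmetric])
qed

text \<open>The two closed half-lines share only the mean, a null set. Discarding it also avoids the
  one point where the case convention for a constant \<open>X\<close> would matter.\<close>

lemma nn_integral_expectile_depth:
  "(\<integral>\<^sup>+x. ennreal ((expectile_depth M X x)\<^sup>2) \<partial>lborel) =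
    (\<integral>\<^sup>+x\<in>{..expectation X}. ennreal ((inv_expectile M X x)\<^sup>2) \<partial>lborel) +
    (\<integral>\<^sup>+x\<in>{expectation X..}. ennreal ((1 - inv_expectile M X x)\<^sup>2) \<partial>lborel)"
proof -
  let ?r = "expectile_depth M X" and ?m = "expectation X"
  have ae: "AE x in lborel. x \<noteq> ?m" by (rule AE_lborel_singleton)
  have "(\<integral>\<^sup>+x. ennreal ((?r x)\<^sup>2) \<partial>lborel) =
      (\<integral>\<^sup>+x. ennreal ((?r x)\<^sup>2) * indicator {..?m} x + ennreal ((?r x)\<^sup>2) * indicator {?m..} x \<partial>lborel)"
    by (rule nn_integral_cong_AE, use ae in eventually_elim) (auto simp: indicator_def)
  also have "\<dots> = (\<integral>\<^sup>+x\<in>{..?m}. ennreal ((?r x)\<^sup>2) \<partial>lborel) + (\<integral>\<^sup>+x\<in>{?m..}. ennreal ((?r x)\<^sup>2) \<partial>lborel)"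
    by (rule nn_integral_add) auto
  also have "(\<integral>\<^sup>+x\<in>{..?m}. ennreal ((?r x)\<^sup>2) \<partial>lborel) =
      (\<integral>\<^sup>+x\<in>{..?m}. ennreal ((inv_expectile M X x)\<^sup>2) \<partial>lborel)"
    by (rule nn_integral_cong_AE, use ae in eventually_elim)
       (auto simp: indicator_def expectile_depth_below_mean)
  also have "(\<integral>\<^sup>+x\<in>{?m..}. ennreal ((?r x)\<^sup>2) \<partial>lborel) =
      (\<integral>\<^sup>+x\<in>{?m..}. ennreal ((1 - inv_expectile M X x)\<^sup>2) \<partial>lborel)"
    by (rule nn_integral_cong_AE, use ae in eventually_elim)
       (auto simp: indicator_def expectile_depth_above_mean)
  finally show ?thesis .
qed

end

theorem proposition3p1:
  fixes M :: "'a measure" and X :: "'a \<Rightarrow> real"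
  assumes "prob_space M" and "complete_measure M" and "integrable M X"
  shows "emeasure (lborel :: (real \<times> real) measure) (expectile_star_set M X) =
      1/2 * (\<integral>\<^sup>+x. ennreal ((radial_function (expectile_star_set M X) (1, x))\<^sup>2) \<partial>(lborel :: real measure))
    \<and> 1/2 * (\<integral>\<^sup>+x. ennreal ((radial_function (expectile_star_set M X) (1, x))\<^sup>2) \<partial>(lborel :: real measure)) =
      1/2 * ((\<integral>\<^sup>+x\<in>{..integral\<^sup>L M X}. ennreal ((inv_expectile M X x)\<^sup>2) \<partial>(lborel :: real measure))
           + (\<integral>\<^sup>+x\<in>{integral\<^sup>L M X..}. ennreal ((1 - inv_expectile M X x)\<^sup>2) \<partial>(lborel :: real measure)))"
proof -
  interpret prob_space M by fact
  interpret integrable_random_variable M X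
    by unfold_locales fact
  show ?thesis
    by (simp only: radial_function_eq emeasure_star_set nn_integral_expectile_depth)
qed

end
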